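(* Let $X$ be a finite uniform Cartesian grid with spacing $h>0$ on a domain in $\mathbb{R}^2$, let $Q\subset X$ be an exit set with exit costs $q:Q\to\mathbb{R}$, let $F>0$ be a speed function on $X$, and let $Z=\{c_1,\dots,c_J\}$ be a decomposition of $X$ into non-overlapping rectangular cells. Let $U:X\to\mathbb{R}$ be the (finite-valued) exact solution of the upwind discretized Eikonal system on $X$ with $U=q$ on $Q$, as defined in the context. Then the generic cell-based label-correcting method, as defined in the context, converges to the exact solution $U$ of this system: upon its termination, its labels satisfy $V_i=U(\mathbf{x}_i)$ for every gridpoint $\mathbf{x}_i\in X$. This holds regardless of the specific exact Eikonal solver used to process individual cells and regardless of the criterion for selecting the next cell to be removed from the list $L$.
   Context: **Grid.** $X$ consists of gridpoints $\mathbf{x}_{ij}=(x_i,y_j)$ of a uniform Cartesian grid with spacing $h$. $N(\mathbf{x})\subset X$ is the set of the (at most four) nearest grid neighbors of $\mathbf{x}$ (east, north, west, south). Gridpoints are also written with a single index, $\mathbf{x}_i$, and values of a function as $V_i=V(\mathbf{x}_i)$. **Discretized Eikonal system.** $U=q$ on $Q$ and, at every $\mathbf{x}_{ij}\in X\setminus Q$, $$\left(\max\left(D^{-x}_{ij}U,\,-D^{+x}_{ij}U,\,0\right)\right)^2+\left(\max\left(D^{-y}_{ij}U,\,-D^{+y}_{ij}U,\,0\right)\right)^2=\frac{1}{F_{ij}^2},$$ where $F_{ij}=F(\mathbf{x}_{ij})$, $D^{\pm x}_{ij}U=\frac{U_{i\pm1,j}-U_{i,j}}{\pm h}$ and $D^{\pm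 y}_{ij}U=\frac{U_{i,j\pm1}-U_{i,j}}{\pm h}$ (a difference involving a neighbor not in $X$ is omitted). Given the neighboring values $U_E,U_N,U_W,U_S$, this equation is solved for the value at $\mathbf{x}_{ij}$ by $\min(U^{NE},U^{NW},U^{SW},U^{SE})$, where $U^{NE}$ is the root $u\ge\max(U_N,U_E)$ of $\left(\frac{u-U_E}{h}\right)^2+\left(\frac{u-U_N}{h}\right)^2=\frac{1}{F_{ij}^2}$ if such a root exists, and $U^{NE}=h/F_{ij}+\min(U_N,U_E)$ otherwise; the other three quadrant updates are defined similarly. In the algorithm below, labels may temporarily equal $+\infty$, and the update formula is applied to them with the usual arithmetic (a label $+\infty$, or a missing neighbor, gives no two-sided root). **Cells.** The cells $c_1,\dots,c_J$ are non-overlapping rectangular blocks of gridpoints covering $X$. $N^c(c)$ is the set of neighboring cells of $c$, i.e. those that exist to the north, south, east and west of $c$. $N^f(c)=\{\mathbf{x}\in X:\mathbf{x}\notin c,\ N(\mathbf{x})\cap c\neq\emptyset\}$. **Processing a cell.** Given current labels $V$, processing $c$ means exactly solving the same discretized equations on $\tilde c=c\cup N^f(c)$ with boundary condition $\tilde q(\mathbf{x}_i)=q(\mathbf{x}_i)$ on $c\cap Q$ and $\tilde q(\mathbf{x}_i)=V_i$ (current labels) on $N^f(c)$, and replacing the labels on $c$ by this solution. Labels outside $c$ are unchanged. Any method that produces this exact solution may be used. **Generic cell-based label-correcting method.** 1. *Cell initialization.* The list $L$ consists of all cells $c_k$ with $c_k\cap Q\neq\emptyset$. 2. *Grid initialization.*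 $V_i=q(\mathbf{x}_i)$ if $\mathbf{x}_i\in Q$, and $V_i=+\infty$ otherwise. 3. *Main loop.* While $L$ is nonempty: remove a cell $c$ from $L$ and process $c$. Then, for each cell $c_k\in N^c(c)\setminus L$, add $c_k$ to $L$ if there exist $\mathbf{x}_i\in c\cap N^f(c_k)$ and $\mathbf{x}_j\in (c_k\cap N(\mathbf{x}_i))\setminus Q$ such that - either $V_i$ has changed, or ($\mathbf{x}_i\in Q$ and $c$ is removed from $L$ for the first time); and - $V_i<V_j$. The method terminates when $L$ is empty. *)

theory Defs
  imports Complex_Main "HOL-Library.Extended_Real" "HOL-Library.Disjoint_Sets"
begin

type_synonym point = "real \<times> real"
type_synonym cell = "point set"

section \<open>Grid\<close>

text \<open>A finite set of nodes of some lattice of spacing \<open>h\<close>; the set need not be a full rectangle, so that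
  it can consist of the lattice nodes lying in an arbitrary bounded domain.\<close>

definition uniform_grid :: "real \<Rightarrow> point set \<Rightarrow> bool" where
  "uniform_grid h X \<longleftrightarrow> finite X \<and>
     (\<exists>x0 y0. \<forall>p\<in>X. \<exists>i j :: int. p = (x0 + of_int i * h, y0 + of_int j * h))"

definition east :: "real \<Rightarrow> point \<Rightarrow> point" where "east h p = (fst p + h, snd p)"
definition north :: "real \<Rightarrow> point \<Rightarrow> point" where "north h p = (fst p, snd p + h)"
definition west :: "real \<Rightarrow> point \<Rightarrow> point" where "west h p = (fst p - h, snd p)"
definition south :: "real \<Rightarrow> point \<Rightarrow> point" where "south h p = (fst p, snd p - h)"

definition nbrs :: "point set \<Rightarrow> real \<Rightarrow> point \<Rightarrow> point set" where
  "nbrs X h p = {east h p, north h p, west h p, south h p} \<inter> X"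

section \<open>Discretized Eikonal system\<close>

definition Dminus_x :: "real \<Rightarrow> (point \<Rightarrow> real) \<Rightarrow> point \<Rightarrow> real" where
  "Dminus_x h U p = (U (west h p) - U p) / (- h)"
definition Dplus_x :: "real \<Rightarrow> (point \<Rightarrow> real) \<Rightarrow> point \<Rightarrow> real" where
  "Dplus_x h U p = (U (east h p) - U p) / h"
definition Dminus_y :: "real \<Rightarrow> (point \<Rightarrow> real) \<Rightarrow> point \<Rightarrow> real" where
  "Dminus_y h U p = (U (south h p) - U p) / (- h)"
definition Dplus_y :: "real \<Rightarrow> (point \<Rightarrow> real) \<Rightarrow> point \<Rightarrow> real" where
  "Dplus_y h U p = (U (north h p) - U p) / h"

text \<open>The maxima range only over those differences whose neighbor lies in \<open>X\<close>.\<close>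

definition upwind_x :: "point set \<Rightarrow> real \<Rightarrow> (point \<Rightarrow> real) \<Rightarrow> point \<Rightarrow> real" where
  "upwind_x X h U p = Max ((if west h p \<in> X then {Dminus_x h U p} else {})
      \<union> (if east h p \<in> X then {- Dplus_x h U p} else {}) \<union> {0})"

definition upwind_y :: "point set \<Rightarrow> real \<Rightarrow> (point \<Rightarrow> real) \<Rightarrow> point \<Rightarrow> real" where
  "upwind_y X h U p = Max ((if south h p \<in> X then {Dminus_y h U p} else {})
      \<union> (if north h p \<in> X then {- Dplus_y h U p} else {}) \<union> {0})"

definition eikonal_solution ::
  "point set \<Rightarrow> real \<Rightarrow> (point \<Rightarrow> real) \<Rightarrow> point set \<Rightarrow> (point \<Rightarrow> real) \<Rightarrow> (point \<Rightarrow> real) \<Rightarrow> bool" where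
  "eikonal_solution X h F Q q U \<longleftrightarrow>
     (\<forall>p\<in>Q. U p = q p) \<and>
     (\<forall>p\<in>X - Q. (upwind_x X h U p)\<^sup>2 + (upwind_y X h U p)\<^sup>2 = 1 / (F p)\<^sup>2)"

section \<open>Update formula for labels in the extended reals\<close>

definition two_sided_root :: "real \<Rightarrow> real \<Rightarrow> ereal \<Rightarrow> ereal \<Rightarrow> real \<Rightarrow> bool" where
  "two_sided_root h f a b u \<longleftrightarrow> (\<exists>\<alpha> \<beta> :: real. a = ereal \<alpha> \<and> b = ereal \<beta> \<and>
     u \<ge> max \<alpha> \<beta> \<and> ((u - \<alpha>) / h)\<^sup>2 + ((u - \<beta>) / h)\<^sup>2 = 1 / f\<^sup>2)"

text \<open>For \<open>h > 0\<close> and \<open>f > 0\<close> there is at most one root \<open>u\<close> satisfying the inequality constraint.\<close>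

definition quadrant_update :: "real \<Rightarrow> real \<Rightarrow> ereal \<Rightarrow> ereal \<Rightarrow> ereal" where
  "quadrant_update h f a b =
     (if \<exists>u. two_sided_root h f a b u then ereal (THE u. two_sided_root h f a b u)
      else ereal (h / f) + min a b)"

text \<open>A missing neighbor is treated as a neighbor with label \<open>\<infinity>\<close>.\<close>

definition label_at :: "point set \<Rightarrow> (point \<Rightarrow> ereal) \<Rightarrow> point \<Rightarrow> ereal" where
  "label_at X V p = (if p \<in> X then V p else \<infinity>)"

definition update :: "point set \<Rightarrow> real \<Rightarrow> (point \<Rightarrow> real) \<Rightarrow> (point \<Rightarrow> ereal) \<Rightarrow> point \<Rightarrow> ereal" where
  "update X h F V p =
     (let VE = label_at X V (east h p); VN = label_at X V (north h p);
          VW = label_at X V (west h p); VS = label_at X V (south h p)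
      in Min {quadrant_update h (F p) VN VE, quadrant_update h (F p) VN VW,
              quadrant_update h (F p) VS VW, quadrant_update h (F p) VS VE})"

section \<open>Cells\<close>

definition rect_block :: "point set \<Rightarrow> point set \<Rightarrow> bool" where
  "rect_block X c \<longleftrightarrow> (\<exists>x1 x2 y1 y2. c = X \<inter> ({x1..x2} \<times> {y1..y2}))"

definition cell_decomposition :: "point set \<Rightarrow> cell set \<Rightarrow> bool" where
  "cell_decomposition X Z \<longleftrightarrow> partition_on X Z \<and> (\<forall>c\<in>Z. rect_block X c)"

definition nbr_cells :: "point set \<Rightarrow> real \<Rightarrow> cell set \<Rightarrow> cell \<Rightarrow> cell set" where
  "nbr_cells X h Z c = {c' \<in> Z. c' \<noteq> c \<and> (\<exists>p\<in>c. nbrs X h p \<inter> c' \<noteq> {})}"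

definition fringe :: "point set \<Rightarrow> real \<Rightarrow> cell \<Rightarrow> point set" where
  "fringe X h c = {p \<in> X. p \<notin> c \<and> nbrs X h p \<inter> c \<noteq> {}}"

text \<open>\<open>W\<close> solves the discretized system on \<open>c \<union> fringe X h c\<close> for the current labels \<open>V\<close>. Since a boundary
  label may be \<open>\<infinity>\<close>, the equations are imposed in the solved form given by the update formula.
  Values lie in \<open>(-\<infinity>, \<infinity>]\<close>; without the last clause, neighboring points of \<open>c - Q\<close> that all have
  the value \<open>-\<infinity>\<close> would satisfy the update formula.\<close>

definition cell_solution :: "point set \<Rightarrow> real \<Rightarrow> (point \<Rightarrow> real) \<Rightarrow> point set \<Rightarrow> (point \<Rightarrow> real)
    \<Rightarrow> cell \<Rightarrow> (point \<Rightarrow> ereal) \<Rightarrow> (point \<Rightarrow> ereal) \<Rightarrow> bool" where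
  "cell_solution X h F Q q c V W \<longleftrightarrow>
     (\<forall>p \<in> c \<inter> Q. W p = ereal (q p)) \<and>
     (\<forall>p \<in> fringe X h c. W p = V p) \<and>
     (\<forall>p \<in> c - Q. W p = update (c \<union> fringe X h c) h F W p) \<and>
     (\<forall>p \<in> c. W p \<noteq> -\<infinity>)"

section \<open>Generic cell-based label-correcting method\<close>

text \<open>A state consists of the list \<open>L\<close>, the set \<open>R\<close> of cells that have already been removed from the list
  at least once, and the labels. Labels outside the grid are irrelevant. The order of \<open>L\<close> plays no
  role, so it is represented by a set.\<close>

type_synonym state = "cell set \<times> cell set \<times> (point \<Rightarrow> ereal)"

definition init_state :: "point set \<Rightarrow> (point \<Rightarrow> real) \<Rightarrow> cell set \<Rightarrow> state" where
  "init_state Q q Z =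
     ({c \<in> Z. c \<inter> Q \<noteq> {}}, {}, \<lambda>p. if p \<in> Q then ereal (q p) else \<infinity>)"

text \<open>Criterion for adding \<open>c'\<close> after processing \<open>c\<close>: \<open>V\<close> and \<open>V'\<close> are the labels before and after the
  processing, and \<open>first\<close> tells whether this was the first removal of \<open>c\<close>.\<close>

definition activates :: "point set \<Rightarrow> real \<Rightarrow> point set \<Rightarrow> bool \<Rightarrow> (point \<Rightarrow> ereal) \<Rightarrow> (point \<Rightarrow> ereal)
    \<Rightarrow> cell \<Rightarrow> cell \<Rightarrow> bool" where
  "activates X h Q first V V' c c' \<longleftrightarrow>
     (\<exists>x \<in> c \<inter> fringe X h c'. \<exists>y \<in> (c' \<inter> nbrs X h x) - Q.
        (V' x \<noteq> V x \<or> (x \<in> Q \<and> first)) \<and> V' x < V' y)"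

text \<open>One pass through the main loop. Neither the choice of \<open>c\<close> nor the way in which \<open>W\<close> is found is
  constrained, so the relation covers every selection rule and every exact solver.\<close>

inductive step :: "point set \<Rightarrow> real \<Rightarrow> (point \<Rightarrow> real) \<Rightarrow> point set \<Rightarrow> (point \<Rightarrow> real) \<Rightarrow> cell set
    \<Rightarrow> state \<Rightarrow> state \<Rightarrow> bool"
  for X h F Q q Z where
  "c \<in> L \<Longrightarrow>
   cell_solution X h F Q q c V W \<Longrightarrow>
   V' = (\<lambda>p. if p \<in> c then W p else V p) \<Longrightarrow>
   L' = L - {c} \<Longrightarrow>
   step X h F Q q Z (L, R, V)
     (L' \<union> {c' \<in> nbr_cells X h Z c - L'. activates X h Q (c \<notin> R) V V' c c'}, insert c R, V')"

end

(* The value u produced by the update formula is the unique root of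
     max (u - U_E) (u - U_W) 0 ^ 2 + max (u - U_N) (u - U_S) 0 ^ 2 = (h / F) ^ 2,
   so it depends only on the neighbors with labels below u. Looking at a point where the smaller of two
   functions is minimal, this yields a comparison principle between super- and subsolutions.

   The labels stay supersolutions and decrease from step to step. When a cell is not activated, the
   neighboring labels that changed are not below its own labels and hence do not influence them; so cells
   outside the list satisfy the subsolution inequality. With an empty list both inequalities hold
   everywhere, and comparison with U gives V = U.

   Termination: a label that is the k-th smallest was obtained from the exit costs by at most k nested
   updates, so labels range over a finite set. Every step lowers a label, removes a cell for the first
   time, or shortens the list. *)

theory Submission
  imports Defs
begin

section \<open>The update formula\<close>

text \<open>The contribution of a neighbor labelled \<open>a\<close> to the equation for
  \<open>u\<close>. The case split is needed because \<open>real_of_ereal \<infinity>\<close> is 0;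
  the same default at -\<infinity> is why later lemmas exclude that label.\<close>

definition gap :: "real \<Rightarrow> ereal \<Rightarrow> real" where
  "gap u a = (if a = \<infinity> then 0 else max 0 (u - real_of_ereal a))"

lemma gap_nonneg: "0 \<le> gap u a"
  by (simp add: gap_def)

lemma gap_PInf [simp]: "gap u \<infinity> = 0"
  by (simp add: gap_def)

lemma gap_ereal [simp]: "gap u (ereal x) = max 0 (u - x)"
  by (simp add: gap_def)

lemma gap_mono: "u \<le> v \<Longrightarrow> gap u a \<le> gap v a"
  by (auto simp: gap_def)

lemma gap_strict_mono: "u < v \<Longrightarrow> 0 < gap v a \<Longrightarrow> gap u a < gap v a"
  by (auto simp: gap_def)

lemma gap_antimono: "a \<le> b \<Longrightarrow> a \<noteq> -\<infinity> \<Longrightarrow> gap u b \<le> gap u a"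
  by (cases a; cases b) (auto simp: gap_def)

lemma gap_eq_0: "ereal u \<le> a \<Longrightarrow> gap u a = 0"
  by (cases a) (auto simp: gap_def)

text \<open>Positivity of the right-hand side makes \<open>x'\<close> or \<open>y'\<close> positive,
  and there strictness enters.\<close>

lemma sum_squares_strict_mono:
  fixes x y :: real
  assumes "0 \<le> x" "x \<le> x'" "0 \<le> y" "y \<le> y'"
    and "0 < x' \<Longrightarrow> x < x'" "0 < y' \<Longrightarrow> y < y'" "0 < x'\<^sup>2 + y'\<^sup>2"
  shows "x\<^sup>2 + y\<^sup>2 < x'\<^sup>2 + y'\<^sup>2"
proof (cases "0 < x'")
  case True
  then have "x\<^sup>2 < x'\<^sup>2" using assms by (intro power_strict_mono) auto
  moreover have "y\<^sup>2 \<le> y'\<^sup>2" using assms by (intro power_mono) auto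
  ultimately show ?thesis by simp
next
  case False
  then have "x' = 0" "x = 0" using assms by auto
  then have "0 < y'" using assms by (cases "y' = 0") auto
  then have "y\<^sup>2 < y'\<^sup>2" using assms by (intro power_strict_mono) auto
  then show ?thesis using \<open>x' = 0\<close> \<open>x = 0\<close> by simp
qed

text \<open>The sum of squares grows with \<open>u\<close>, strictly up to any point where it is
  positive. So the positive level \<open>r\<^sup>2\<close> is attained at \<open>v\<close>
  only.\<close>

lemma gap_sum_ge_iff:
  assumes "(gap v a)\<^sup>2 + (gap v b)\<^sup>2 = r\<^sup>2" "0 < r"
  shows "r\<^sup>2 \<le> (gap u a)\<^sup>2 + (gap u b)\<^sup>2 \<longleftrightarrow> v \<le> u"
proof
  assume "v \<le> u"
  then have "(gap v a)\<^sup>2 \<le> (gap u a)\<^sup>2" "(gap v b)\<^sup>2 \<le> (gap u b)\<^sup>2"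
    by (auto intro!: power_mono gap_mono gap_nonneg)
  then show "r\<^sup>2 \<le> (gap u a)\<^sup>2 + (gap u b)\<^sup>2" using assms by linarith
next
  assume le: "r\<^sup>2 \<le> (gap u a)\<^sup>2 + (gap u b)\<^sup>2"
  show "v \<le> u"
  proof (rule ccontr)
    assume "\<not> v \<le> u"
    then have "(gap u a)\<^sup>2 + (gap u b)\<^sup>2 < (gap v a)\<^sup>2 + (gap v b)\<^sup>2"
      using assms by (intro sum_squares_strict_mono gap_nonneg gap_mono gap_strict_mono) auto
    then show False using le assms by simp
  qed
qed

lemma two_sided_root_real:
  "two_sided_root h f (ereal x) (ereal y) u \<longleftrightarrow>
     max x y \<le> u \<and> ((u - x) / h)\<^sup>2 + ((u - y) / h)\<^sup>2 = 1 / f\<^sup>2"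
  by (simp add: two_sided_root_def)

lemma two_sided_root_gap:
  assumes "0 < h" "0 < f" "two_sided_root h f a b u"
  shows "(gap u a)\<^sup>2 + (gap u b)\<^sup>2 = (h / f)\<^sup>2"
proof -
  obtain x y where xy: "a = ereal x" "b = ereal y" "max x y \<le> u"
      and eq: "((u - x) / h)\<^sup>2 + ((u - y) / h)\<^sup>2 = 1 / f\<^sup>2"
    using assms(3) unfolding two_sided_root_def by blast
  have "(u - x)\<^sup>2 + (u - y)\<^sup>2 = h\<^sup>2 * (((u - x) / h)\<^sup>2 + ((u - y) / h)\<^sup>2)"
    using assms(1) by (simp add: power_divide distrib_left)
  also have "\<dots> = (h / f)\<^sup>2"
    unfolding eq by (simp add: power_divide)
  finally show ?thesis using xy by simp
qed

lemma two_sided_root_exists: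
  assumes "0 < h" "0 < f" "x \<le> y" "y - x \<le> h / f"
  shows "\<exists>u. two_sided_root h f (ereal x) (ereal y) u"
proof -
  define d where "d = y - x"
  \<comment> \<open>Up to a constant factor \<open>s\<close> is the root of the discriminant of the
    quadratic for \<open>u\<close>, and \<open>u\<close> is the larger solution. The bound on
    \<open>y - x\<close> gives \<open>d \<le> s\<close>, which amounts to
    \<open>y \<le> u\<close>.\<close>
  define s where "s = sqrt (2 * (h / f)\<^sup>2 - d\<^sup>2)"
  define u where "u = (x + y + s) / 2"
  have d: "0 \<le> d" "d\<^sup>2 \<le> (h / f)\<^sup>2"
    using assms by (auto simp: d_def intro: power_mono)
  have "0 \<le> 2 * (h / f)\<^sup>2 - d\<^sup>2" using d(2) zero_le_power2[of "h / f"] by linarith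
  then have s2: "s\<^sup>2 = 2 * (h / f)\<^sup>2 - d\<^sup>2" by (simp add: s_def)
  have "d \<le> s" unfolding s_def using d by (intro real_le_rsqrt) linarith
  then have "y \<le> u" by (simp add: u_def d_def field_simps)
  have "(u - x)\<^sup>2 + (u - y)\<^sup>2 = (d\<^sup>2 + s\<^sup>2) / 2"
    by (simp add: u_def d_def power2_eq_square field_simps)
  also have "\<dots> = (h / f)\<^sup>2" using s2 by simp
  finally have eq: "(u - x)\<^sup>2 + (u - y)\<^sup>2 = (h / f)\<^sup>2" .
  have "((u - x) / h)\<^sup>2 + ((u - y) / h)\<^sup>2 = ((u - x)\<^sup>2 + (u - y)\<^sup>2) / h\<^sup>2"
    by (simp add: power_divide add_divide_distrib)
  also have "\<dots> = 1 / f\<^sup>2" unfolding eq using assms by (simp add: power_divide)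
  finally show ?thesis using \<open>y \<le> u\<close> assms by (auto simp: two_sided_root_real)
qed

lemma two_sided_root_commute: "two_sided_root h f a b = two_sided_root h f b a"
  unfolding two_sided_root_def by (rule ext) (auto simp: add.commute)

lemma quadrant_update_commute: "quadrant_update h f a b = quadrant_update h f b a"
  unfolding quadrant_update_def two_sided_root_commute[of h f a b] min.commute[of a b] ..

lemma quadrant_update_PInf: "quadrant_update h f \<infinity> \<infinity> = \<infinity>"
  by (simp add: quadrant_update_def two_sided_root_def)

text \<open>Both branches of the update solve one and the same equation: without a two-sided root,
  \<open>b\<close> lies above the one-sided value and has zero gap there.\<close>

lemma quadrant_update_root:
  assumes "0 < h" "0 < f" "a \<le> b" "a \<noteq> -\<infinity>" "a \<noteq> \<infinity>"
  shows "\<exists>u. quadrant_update h f a b = ereal u \<and> (gap u a)\<^sup>2 + (gap u b)\<^sup>2 = (h / f)\<^sup>2"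
proof (cases "\<exists>u. two_sided_root h f a b u")
  case True
  then obtain u where u: "two_sided_root h f a b u" by blast
  \<comment> \<open>Two roots bound each other by \<open>gap_sum_ge_iff\<close>, so
    \<open>THE\<close> is well defined.\<close>
  have "v = u" if v: "two_sided_root h f a b v" for v
  proof -
    have r: "0 < h / f" using assms by simp
    note gu = two_sided_root_gap[OF assms(1,2) u] and gv = two_sided_root_gap[OF assms(1,2) v]
    show ?thesis
      using gap_sum_ge_iff[OF gu r, of v] gap_sum_ge_iff[OF gv r, of u] gu gv by auto
  qed
  then have "(THE u. two_sided_root h f a b u) = u" using u by blast
  then have "quadrant_update h f a b = ereal u" using True by (simp add: quadrant_update_def)
  then show ?thesis using two_sided_root_gap[OF assms(1,2) u] by blast
next
  case False
  obtain x where x: "a = ereal x" using assms by (cases a) auto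
  have "gap (h / f + x) b = 0"
  proof (cases b)
    case (real y)
    have "\<not> y - x \<le> h / f"
      using two_sided_root_exists[OF assms(1,2), of x y] False assms(3) x real by auto
    then show ?thesis using real by simp
  qed (use assms x in auto)
  moreover have "quadrant_update h f a b = ereal (h / f + x)"
    using False assms x by (simp add: quadrant_update_def min_absorb1)
  ultimately show ?thesis using assms x by (intro exI[of _ "h / f + x"]) simp
qed

lemma quadrant_update_le_iff_aux:
  assumes "0 < h" "0 < f" "a \<le> b" "a \<noteq> -\<infinity>"
  shows "quadrant_update h f a b \<noteq> -\<infinity> \<and>
    (quadrant_update h f a b \<le> ereal u \<longleftrightarrow> (h / f)\<^sup>2 \<le> (gap u a)\<^sup>2 + (gap u b)\<^sup>2)"
proof (cases "a = \<infinity>")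
  case True
  then have "b = \<infinity>" using assms by simp
  then show ?thesis using True assms by (simp add: quadrant_update_PInf)
next
  case False
  then obtain v where v: "quadrant_update h f a b = ereal v"
      "(gap v a)\<^sup>2 + (gap v b)\<^sup>2 = (h / f)\<^sup>2"
    using quadrant_update_root assms by blast
  then show ?thesis using gap_sum_ge_iff[OF v(2)] assms by simp
qed

text \<open>Comparing the update with a real number becomes an inequality free of case distinctions.
  An infinite update fits in, since it arises from infinite labels, whose gaps vanish.\<close>

lemma
  assumes "0 < h" "0 < f" "a \<noteq> -\<infinity>" "b \<noteq> -\<infinity>"
  shows quadrant_update_neq_MInf: "quadrant_update h f a b \<noteq> -\<infinity>"
    and quadrant_update_le_iff:
      "quadrant_update h f a b \<le> ereal u \<longleftrightarrow> (h / f)\<^sup>2 \<le> (gap u a)\<^sup>2 + (gap u b)\<^sup>2"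
proof -
  have "quadrant_update h f a b \<noteq> -\<infinity> \<and>
    (quadrant_update h f a b \<le> ereal u \<longleftrightarrow> (h / f)\<^sup>2 \<le> (gap u a)\<^sup>2 + (gap u b)\<^sup>2)"
  proof (cases "a \<le> b")
    case True
    then show ?thesis using quadrant_update_le_iff_aux assms by blast
  next
    case False
    then show ?thesis
      using quadrant_update_le_iff_aux[of h f b a u] assms
      by (simp add: quadrant_update_commute[of h f a b] add.commute)
  qed
  then show "quadrant_update h f a b \<noteq> -\<infinity>"
    "quadrant_update h f a b \<le> ereal u \<longleftrightarrow> (h / f)\<^sup>2 \<le> (gap u a)\<^sup>2 + (gap u b)\<^sup>2"
    by blast+
qed

section \<open>The four-quadrant update: threshold form and causality\<close>

text \<open>This is \<open>h\<close> times the upwind difference in the x-direction, with the value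
  at \<open>p\<close> left free as \<open>u\<close> and infinite neighbors allowed.\<close>

definition gap_x :: "point set \<Rightarrow> real \<Rightarrow> (point \<Rightarrow> ereal) \<Rightarrow> point \<Rightarrow> real \<Rightarrow> real" where
  "gap_x X h V p u = max (gap u (label_at X V (east h p))) (gap u (label_at X V (west h p)))"

definition gap_y :: "point set \<Rightarrow> real \<Rightarrow> (point \<Rightarrow> ereal) \<Rightarrow> point \<Rightarrow> real \<Rightarrow> real" where
  "gap_y X h V p u = max (gap u (label_at X V (north h p))) (gap u (label_at X V (south h p)))"

lemma gap_x_nonneg: "0 \<le> gap_x X h V p u" and gap_y_nonneg: "0 \<le> gap_y X h V p u"
  by (auto simp: gap_x_def gap_y_def gap_nonneg le_max_iff_disj)

text \<open>Squaring respects maxima of nonnegative numbers, so the sum splits into four quadrants.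
  With east, west, north, south for \<open>a\<close>, \<open>b\<close>, \<open>c\<close>,
  \<open>d\<close>, the disjuncts follow the order in \<open>update\<close>.\<close>

lemma le_sum_max_squares_iff:
  fixes a b c d r :: real
  assumes "0 \<le> a" "0 \<le> b" "0 \<le> c" "0 \<le> d"
  shows "r \<le> (max a b)\<^sup>2 + (max c d)\<^sup>2 \<longleftrightarrow>
    r \<le> c\<^sup>2 + a\<^sup>2 \<or> r \<le> c\<^sup>2 + b\<^sup>2 \<or> r \<le> d\<^sup>2 + b\<^sup>2 \<or> r \<le> d\<^sup>2 + a\<^sup>2"
proof -
  have "(max a b)\<^sup>2 = max (a\<^sup>2) (b\<^sup>2)" "(max c d)\<^sup>2 = max (c\<^sup>2) (d\<^sup>2)"
    using assms by (auto simp: max_def)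
  then show ?thesis by (auto simp: max_def)
qed

lemma label_at_neq_MInf:
  assumes "\<And>x. x \<in> nbrs X h p \<Longrightarrow> V x \<noteq> -\<infinity>" "y \<in> {east h p, north h p, west h p, south h p}"
  shows "label_at X V y \<noteq> -\<infinity>"
  using assms by (auto simp: label_at_def nbrs_def)

lemma
  assumes "0 < h" "0 < F p" "\<And>x. x \<in> nbrs X h p \<Longrightarrow> V x \<noteq> -\<infinity>"
  shows update_neq_MInf: "update X h F V p \<noteq> -\<infinity>"
    and update_le_iff: "update X h F V p \<le> ereal u \<longleftrightarrow>
      (h / F p)\<^sup>2 \<le> (gap_x X h V p u)\<^sup>2 + (gap_y X h V p u)\<^sup>2"
proof -
  note nm = label_at_neq_MInf[OF assms(3)]
  show "update X h F V p \<noteq> -\<infinity>"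
    unfolding update_def Let_def
    by (simp add: min_def quadrant_update_neq_MInf[OF assms(1,2) nm nm])
  show "update X h F V p \<le> ereal u \<longleftrightarrow>
      (h / F p)\<^sup>2 \<le> (gap_x X h V p u)\<^sup>2 + (gap_y X h V p u)\<^sup>2"
    unfolding update_def Let_def gap_x_def gap_y_def
    by (simp add: Min_le_iff quadrant_update_le_iff[OF assms(1,2) nm nm]
        le_sum_max_squares_iff gap_nonneg min_le_iff_disj)
qed

text \<open>Causality joined with monotonicity: a neighbor whose label in \<open>V\<close> is not
  below the updated value has zero gap there, so passing to \<open>W\<close> cannot reduce its gap.
  The two labels need comparing only at the smaller neighbors.\<close>

lemma update_le_update:
  assumes "0 < h" "0 < F p"
    and "\<And>x. x \<in> nbrs X h p \<Longrightarrow> V x \<noteq> -\<infinity>" "\<And>x. x \<in> nbrs X h p \<Longrightarrow> W x \<noteq> -\<infinity>"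
    and le: "\<And>x. x \<in> nbrs X h p \<Longrightarrow> V x < update X h F V p \<Longrightarrow> W x \<le> V x"
  shows "update X h F W p \<le> update X h F V p"
proof (cases "update X h F V p")
  case (real u)
  have g: "gap u (label_at X V y) \<le> gap u (label_at X W y)"
    if y: "y \<in> {east h p, north h p, west h p, south h p}" for y
  proof (cases "y \<in> X \<and> V y < ereal u")
    case True
    then have n: "y \<in> nbrs X h p" using y by (auto simp: nbrs_def)
    then have "W y \<le> V y" using le True real by simp
    then show ?thesis using True gap_antimono assms(4)[OF n] by (simp add: label_at_def)
  next
    case False
    then have "ereal u \<le> label_at X V y" by (auto simp: label_at_def)
    then show ?thesis using gap_eq_0 gap_nonneg by metis
  qed
  have "gap_x X h V p u \<le> gap_x X h W p u" "gap_y X h V p u \<le> gap_y X h W p u"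
    unfolding gap_x_def gap_y_def by (intro max.mono g; simp)+
  then have "(gap_x X h V p u)\<^sup>2 + (gap_y X h V p u)\<^sup>2 \<le> (gap_x X h W p u)\<^sup>2 + (gap_y X h W p u)\<^sup>2"
    by (intro add_mono power_mono gap_x_nonneg gap_y_nonneg)
  moreover have "(h / F p)\<^sup>2 \<le> (gap_x X h V p u)\<^sup>2 + (gap_y X h V p u)\<^sup>2"
    using update_le_iff[of h F p X V u] assms(1,2,3) real by simp
  ultimately have "update X h F W p \<le> ereal u"
    using update_le_iff[of h F p X W u] assms(1,2,4) by simp
  then show ?thesis using real by simp
next
  case MInf
  then show ?thesis using update_neq_MInf[of h F p X V] assms(1,2,3) by blast
qed simp

text \<open>At \<open>u = m\<close> all gaps vanish, while the threshold
  \<open>(h / F p)\<^sup>2\<close> is positive.\<close>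

lemma update_ge:
  assumes "0 < h" "0 < F p" "\<And>x. x \<in> nbrs X h p \<Longrightarrow> ereal m \<le> V x"
  shows "ereal m \<le> update X h F V p"
proof (rule ccontr)
  have nm: "V x \<noteq> -\<infinity>" if "x \<in> nbrs X h p" for x using assms(3)[OF that] by auto
  assume "\<not> ereal m \<le> update X h F V p"
  then have "update X h F V p \<le> ereal m" by simp
  then have "(h / F p)\<^sup>2 \<le> (gap_x X h V p m)\<^sup>2 + (gap_y X h V p m)\<^sup>2"
    using update_le_iff[of h F p X V m] assms(1,2) nm by blast
  moreover have g: "gap m (label_at X V y) = 0"
    if y: "y \<in> {east h p, north h p, west h p, south h p}" for y
    using assms(3)[of y] y by (intro gap_eq_0) (auto simp: label_at_def nbrs_def)
  ultimately show False using assms(1,2) g by (simp add: gap_x_def gap_y_def)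
qed

section \<open>From upwind differences to the solved form\<close>

lemma upwind_x_gap:
  assumes "0 < h"
  shows "upwind_x X h U p = gap_x X h (\<lambda>x. ereal (U x)) p (U p) / h"
proof -
  have "(U (west h p) - U p) / (- h) = (U p - U (west h p)) / h"
    "- ((U (east h p) - U p) / h) = (U p - U (east h p)) / h"
    by (metis minus_diff_eq minus_divide_left minus_divide_right)+
  then show ?thesis using assms
    by (auto simp: upwind_x_def Dminus_x_def Dplus_x_def gap_x_def label_at_def max_def divide_le_cancel
        zero_le_divide_iff field_simps)
qed

lemma upwind_y_gap:
  assumes "0 < h"
  shows "upwind_y X h U p = gap_y X h (\<lambda>x. ereal (U x)) p (U p) / h"
proof -
  have "(U (south h p) - U p) / (- h) = (U p - U (south h p)) / h"
    "- ((U (north h p) - U p) / h) = (U p - U (north h p)) / h"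
    by (metis minus_diff_eq minus_divide_left minus_divide_right)+
  then show ?thesis using assms
    by (auto simp: upwind_y_def Dminus_y_def Dplus_y_def gap_y_def label_at_def max_def divide_le_cancel
        zero_le_divide_iff field_simps)
qed

lemma gap_x_strict_mono: "u < v \<Longrightarrow> 0 < gap_x X h V p v \<Longrightarrow> gap_x X h V p u < gap_x X h V p v"
  and gap_y_strict_mono: "u < v \<Longrightarrow> 0 < gap_y X h V p v \<Longrightarrow> gap_y X h V p u < gap_y X h V p v"
  unfolding gap_x_def gap_y_def gap_def by (auto simp: max_def split: if_splits)

lemma gap_x_mono: "u \<le> v \<Longrightarrow> gap_x X h V p u \<le> gap_x X h V p v"
  and gap_y_mono: "u \<le> v \<Longrightarrow> gap_y X h V p u \<le> gap_y X h V p v"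
  unfolding gap_x_def gap_y_def by (intro max.mono gap_mono; assumption)+

text \<open>The difference equation says that the squared gaps attain the threshold at
  \<open>U p\<close>; by strict growth no smaller value reaches it.\<close>

lemma eikonal_update:
  assumes "0 < h" "0 < F p" and eq: "(upwind_x X h U p)\<^sup>2 + (upwind_y X h U p)\<^sup>2 = 1 / (F p)\<^sup>2"
  shows "update X h F (\<lambda>x. ereal (U x)) p = ereal (U p)"
proof (rule antisym)
  let ?U = "\<lambda>x. ereal (U x)"
  let ?g = "\<lambda>u. (gap_x X h ?U p u)\<^sup>2 + (gap_y X h ?U p u)\<^sup>2"
  have "?g (U p) = h\<^sup>2 * ((upwind_x X h U p)\<^sup>2 + (upwind_y X h U p)\<^sup>2)"
    using assms(1) by (simp add: upwind_x_gap upwind_y_gap power_divide distrib_left)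
  also have "\<dots> = (h / F p)\<^sup>2" unfolding eq by (simp add: power_divide)
  finally have g: "?g (U p) = (h / F p)\<^sup>2" .
  have le: "update X h F ?U p \<le> ereal u \<longleftrightarrow> (h / F p)\<^sup>2 \<le> ?g u" for u
    by (rule update_le_iff) (use assms in auto)
  show "update X h F ?U p \<le> ereal (U p)" using le g by simp
  have "\<not> update X h F ?U p \<le> ereal u" if "u < U p" for u
  proof -
    have "?g u < ?g (U p)"
      using that g assms(1,2)
      by (intro sum_squares_strict_mono gap_x_nonneg gap_y_nonneg gap_x_mono gap_y_mono
          gap_x_strict_mono gap_y_strict_mono) auto
    then show ?thesis using le g by simp
  qed
  moreover have "update X h F ?U p \<noteq> -\<infinity>"
    by (rule update_neq_MInf) (use assms in auto)
  ultimately show "ereal (U p) \<le> update X h F ?U p"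
    by (cases "update X h F ?U p") (auto simp: not_le[symmetric])
qed

lemma nbrs_commute: "x \<in> X \<Longrightarrow> p \<in> X \<Longrightarrow> x \<in> nbrs X h p \<longleftrightarrow> p \<in> nbrs X h x"
  by (cases x; cases p) (auto simp: nbrs_def east_def west_def north_def south_def)

section \<open>Labels of the method\<close>

locale eikonal_grid =
  fixes X Q :: "point set" and h :: real and q F :: "point \<Rightarrow> real" and Z :: "cell set"
  assumes h_pos: "0 < h" and fin_X: "finite X" and Q_sub: "Q \<subseteq> X"
    and F_pos: "p \<in> X \<Longrightarrow> 0 < F p" and part: "partition_on X Z"
begin

abbreviation upd :: "(point \<Rightarrow> ereal) \<Rightarrow> point \<Rightarrow> ereal" where
  "upd \<equiv> update X h F"

lemma nbrs_in: "x \<in> nbrs X h p \<Longrightarrow> x \<in> X"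
  by (auto simp: nbrs_def)

lemma cell_sub: "c \<in> Z \<Longrightarrow> c \<subseteq> X"
  using part by (auto simp: partition_on_def)

lemma cell_eq: "c \<in> Z \<Longrightarrow> c' \<in> Z \<Longrightarrow> x \<in> c \<Longrightarrow> x \<in> c' \<Longrightarrow> c = c'"
  using part by (auto simp: partition_on_def disjoint_def)

lemma fin_Z: "finite Z"
  using finite_elements[OF fin_X part] .

lemma upd_mono:
  assumes "p \<in> X" "\<And>x. x \<in> X \<Longrightarrow> W x \<noteq> -\<infinity>" "\<And>x. x \<in> X \<Longrightarrow> W x \<le> V x"
  shows "upd W p \<le> upd V p"
proof (rule update_le_update)
  fix x assume "x \<in> nbrs X h p"
  then have "x \<in> X" by (rule nbrs_in)
  then show "W x \<noteq> -\<infinity>" "W x \<le> V x" "V x \<noteq> -\<infinity>"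
    using assms(2,3)[of x] by auto
qed (use assms(1) h_pos F_pos in auto)

section \<open>Comparison principle\<close>

text \<open>At a point \<open>b\<close> where \<open>V\<close> is least among the points violating
  the claim, every neighbor with label below \<open>V b\<close> satisfies it. Causality then yields
  \<open>W b \<le> upd W b \<le> upd V b \<le> V b\<close>.\<close>

lemma comparison:
  assumes "\<And>x. x \<in> X \<Longrightarrow> V x \<noteq> -\<infinity>" "\<And>x. x \<in> X \<Longrightarrow> W x \<noteq> -\<infinity>"
    and super: "\<And>x. x \<in> A \<Longrightarrow> upd V x \<le> V x" and sub: "\<And>x. x \<in> A \<Longrightarrow> W x \<le> upd W x"
    and bdry: "\<And>x. x \<in> X \<Longrightarrow> x \<notin> A \<Longrightarrow> W x \<le> V x"
    and "p \<in> X"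
  shows "W p \<le> V p"
proof (rule ccontr)
  assume "\<not> W p \<le> V p"
  define B where "B = {x \<in> X. V x < W x}"
  have "finite B" "p \<in> B" using fin_X \<open>p \<in> X\<close> \<open>\<not> W p \<le> V p\<close> by (simp_all add: B_def)
  then have "finite (V ` B)" "V ` B \<noteq> {}" by auto
  then obtain v where "v \<in> V ` B" "\<not> (\<exists>w\<in>V ` B. w < v)"
    using ex_min_if_finite by meson
  then obtain b where b: "b \<in> B" and min: "\<And>x. x \<in> B \<Longrightarrow> \<not> V x < V b"
    by blast
  have bX: "b \<in> X" and lt: "V b < W b" using b by (auto simp: B_def)
  then have bA: "b \<in> A" using bdry[OF bX] by (meson leD)
  have "upd W b \<le> upd V b"
  proof (rule update_le_update)
    fix x assume "x \<in> nbrs X h b" "V x < upd V b"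
    then have "x \<in> X" "V x < V b" using super[OF bA] nbrs_in by (blast, simp)
    then show "W x \<le> V x" using min[of x] by (intro leI) (auto simp: B_def)
  next
    show "V x \<noteq> -\<infinity>" "W x \<noteq> -\<infinity>" if "x \<in> nbrs X h b" for x
      using that nbrs_in assms(1,2) by blast+
  qed (use h_pos F_pos bX in auto)
  then have "W b \<le> V b" using sub[OF bA] super[OF bA] by order
  then show False using lt by simp
qed

section \<open>Solving the system on one cell\<close>

text \<open>Every grid neighbor of a point of \<open>c\<close> lies in \<open>c\<close> or in the
  fringe, so the local and the global update read the same labels.\<close>

lemma cell_solution_update:
  assumes "cell_solution X h F Q q c V W" "c \<subseteq> X" "p \<in> c - Q"
  shows "W p = upd (\<lambda>x. if x \<in> c then W x else V x) p"
proof -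
  let ?V = "\<lambda>x. if x \<in> c then W x else V x"
  have "label_at (c \<union> fringe X h c) W y = label_at X ?V y"
    if y: "y \<in> {east h p, north h p, west h p, south h p}" for y
  proof (cases "y \<in> X - c")
    case True
    then have "y \<in> nbrs X h p" using y by (auto simp: nbrs_def)
    then have "p \<in> nbrs X h y" using nbrs_commute True assms by blast
    then have "y \<in> fringe X h c" using True assms by (auto simp: fringe_def)
    then show ?thesis using True assms(1) by (auto simp: label_at_def cell_solution_def)
  next
    case False
    then show ?thesis using assms(2) by (auto simp: label_at_def fringe_def)
  qed
  then have "update (c \<union> fringe X h c) h F W p = upd ?V p"
    by (simp add: update_def)
  then show ?thesis using assms by (auto simp: cell_solution_def)
qed

text \<open>A monotone operator on the complete lattice of labelings has a fixed point. Monotonicity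
  of the update is available only away from -\<infinity>, hence its arguments are cut off below at
  \<open>m\<close>.\<close>

lemma cell_solution_exists:
  assumes "c \<subseteq> X" "\<And>x. x \<in> X \<Longrightarrow> V x \<noteq> -\<infinity>"
  shows "\<exists>W. cell_solution X h F Q q c V W"
proof -
  \<comment> \<open>A real lower bound for all the data; an infinite label counts as 0 here, which
    is harmless for a lower bound.\<close>
  define m where "m = Min (insert 0 (q ` (c \<inter> Q) \<union> real_of_ereal ` V ` X))"
  have fin: "finite (insert 0 (q ` (c \<inter> Q) \<union> real_of_ereal ` V ` X))"
    using fin_X finite_subset[OF assms(1)] by auto
  have mq: "m \<le> q x" if "x \<in> c \<inter> Q" for x
    unfolding m_def using fin that by (intro Min_le) auto
  have "m \<le> real_of_ereal (V x)" if "x \<in> X" for x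
    unfolding m_def using fin that by (intro Min_le) auto
  then have mV: "ereal m \<le> V x" if "x \<in> X" for x
  proof (cases "V x")
    case (real r)
    then show ?thesis using that \<open>\<And>x. x \<in> X \<Longrightarrow> m \<le> real_of_ereal (V x)\<close>[of x] by simp
  qed (use assms(2)[OF that] in auto)
  define T where "T = (\<lambda>W p. if p \<in> c \<inter> Q then ereal (q p)
    else if p \<in> c then upd (\<lambda>x. max (ereal m) (W x)) p else V p)"
  have "mono T"
  proof (rule monoI, rule le_funI)
    fix W W' :: "point \<Rightarrow> ereal" and p assume "W \<le> W'"
    have "max (ereal m) (W x) \<le> max (ereal m) (W' x)" for x
      using \<open>W \<le> W'\<close> by (intro max.mono order_refl) (rule le_funD)
    then have "upd (\<lambda>x. max (ereal m) (W x)) p \<le> upd (\<lambda>x. max (ereal m) (W' x)) p" if "p \<in> c"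
      using that assms(1) by (intro upd_mono) (auto simp: max_def)
    then show "T W p \<le> T W' p" by (simp add: T_def)
  qed
  define W where "W = gfp T"
  have W: "W = T W" unfolding W_def by (rule gfp_unfold[OF \<open>mono T\<close>])
  \<comment> \<open>On the grid all values of \<open>T\<close> are at least \<open>m\<close>, hence
    so is the fixed point, and the cutoff does not affect it.\<close>
  have mW: "ereal m \<le> W x" if "x \<in> X" for x
  proof -
    have "ereal m \<le> upd (\<lambda>x. max (ereal m) (W x)) x"
      by (rule update_ge) (use h_pos F_pos that in auto)
    then have "ereal m \<le> T W x" using mq mV that by (simp add: T_def)
    then show ?thesis using W by simp
  qed
  have lab: "label_at (c \<union> fringe X h c) W y = label_at X (\<lambda>x. max (ereal m) (W x)) y"
    if p: "p \<in> c" and y: "y \<in> {east h p, north h p, west h p, south h p}" for p y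
  proof (cases "y \<in> X")
    case True
    then have "y \<in> nbrs X h p" using y by (auto simp: nbrs_def)
    then have "p \<in> nbrs X h y" using nbrs_commute True assms(1) p by blast
    then have "y \<in> c \<union> fringe X h c" using True p by (auto simp: fringe_def)
    then show ?thesis using True mW by (simp add: label_at_def max_absorb2)
  next
    case False
    then show ?thesis using assms(1) by (auto simp: label_at_def fringe_def)
  qed
  have "W p = update (c \<union> fringe X h c) h F W p" if "p \<in> c - Q" for p
  proof -
    have "W p = upd (\<lambda>x. max (ereal m) (W x)) p"
      using that by (subst W) (simp add: T_def)
    also have "\<dots> = update (c \<union> fringe X h c) h F W p"
      using that by (simp add: update_def lab[of p])
    finally show ?thesis .
  qed
  moreover have "W p = ereal (q p)" if "p \<in> c \<inter> Q" for p
    using that by (subst W) (simp add: T_def)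
  moreover have "W p = V p" if "p \<in> fringe X h c" for p
    using that by (subst W) (simp add: T_def fringe_def)
  moreover have "W p \<noteq> -\<infinity>" if "p \<in> c" for p
    using mW[of p] that assms(1) by auto
  ultimately show ?thesis unfolding cell_solution_def by blast
qed

section \<open>A finite set of attainable labels\<close>

text \<open>\<infinity> is included from the start to stand for absent or ignored neighbors.\<close>

primrec vals :: "nat \<Rightarrow> ereal set" where
  "vals 0 = insert \<infinity> ((\<lambda>p. ereal (q p)) ` Q)"
| "vals (Suc n) = vals n \<union> {upd V p | V p. p \<in> X \<and> (\<forall>x\<in>X. V x \<in> vals n)}"

lemma PInf_in_vals: "\<infinity> \<in> vals n"
  by (induction n) auto

lemma vals_mono: "m \<le> n \<Longrightarrow> vals m \<subseteq> vals n"
  by (rule lift_Suc_mono_le[of vals]) auto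

text \<open>Infinitely many labelings \<open>V\<close> occur, but an update depends only on
  \<open>F p\<close> and four labels, so the new values lie in the image of a finite
  product.\<close>

lemma finite_vals: "finite (vals n)"
proof (induction n)
  case 0
  then show ?case using finite_subset[OF Q_sub fin_X] by simp
next
  case (Suc n)
  let ?f = "\<lambda>(f, a, b, c, d). Min {quadrant_update h f b a, quadrant_update h f b c,
    quadrant_update h f d c, quadrant_update h f d a}"
  have lab: "label_at X V y \<in> vals n" if "\<forall>x\<in>X. V x \<in> vals n" for V y
    using that PInf_in_vals by (simp add: label_at_def)
  have "{upd V p | V p. p \<in> X \<and> (\<forall>x\<in>X. V x \<in> vals n)}
      \<subseteq> ?f ` (F ` X \<times> vals n \<times> vals n \<times> vals n \<times> vals n)"
  proof clarify
    fix V p assume "p \<in> X" "\<forall>x\<in>X. V x \<in> vals n"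
    then show "upd V p \<in> ?f ` (F ` X \<times> vals n \<times> vals n \<times> vals n \<times> vals n)"
      by (intro image_eqI[of _ _ "(F p, label_at X V (east h p), label_at X V (north h p),
            label_at X V (west h p), label_at X V (south h p))"])
         (auto simp: update_def Let_def lab)
  qed
  moreover have "finite (?f ` (F ` X \<times> vals n \<times> vals n \<times> vals n \<times> vals n))"
    using Suc fin_X by (intro finite_imageI finite_cartesian_product)
  ultimately have "finite {upd V p | V p. p \<in> X \<and> (\<forall>x\<in>X. V x \<in> vals n)}"
    by (rule finite_subset)
  with Suc show ?case by simp
qed

text \<open>Serves as a bound on the nesting depth of the updates behind a label: the labels that
  determine it are strictly smaller and have smaller rank.\<close>

definition rank :: "(point \<Rightarrow> ereal) \<Rightarrow> point \<Rightarrow> nat" where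
  "rank V p = card {x \<in> X. V x < V p}"

lemma rank_le_card: "rank V p \<le> card X"
  unfolding rank_def using fin_X by (intro card_mono) auto

lemma rank_strict_mono: "x \<in> X \<Longrightarrow> V x < V p \<Longrightarrow> rank V x < rank V p"
  unfolding rank_def using fin_X by (intro psubset_card_mono psubsetI) (auto dest: less_trans)

lemma upd_PInf:
  assumes "\<And>x. x \<in> X \<Longrightarrow> V x = \<infinity>"
  shows "upd V p = \<infinity>"
proof -
  have "label_at X V y = \<infinity>" for y using assms by (simp add: label_at_def)
  then show ?thesis unfolding update_def Let_def by (simp add: quadrant_update_PInf)
qed

text \<open>By causality a label is determined by the labels below it, which have smaller rank. Since labels only
  decrease, the rank of an unchanged label only grows, so that this bound survives later steps.\<close>

lemma vals_rank_update:
  assumes "\<And>x. x \<in> X \<Longrightarrow> V x \<noteq> -\<infinity>" "p \<in> X" "V p = upd V p"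
    and "\<And>x. x \<in> X \<Longrightarrow> V x < V p \<Longrightarrow> V x \<in> vals (rank V x)"
  shows "V p \<in> vals (rank V p)"
proof -
  \<comment> \<open>Labels not below \<open>V p\<close> are erased; by causality the update at
    \<open>p\<close> stays the same.\<close>
  define W where "W x = (if V x < V p then V x else \<infinity>)" for x
  have nm: "W x \<noteq> -\<infinity>" if "x \<in> X" for x using assms(1)[OF that] by (simp add: W_def)
  have "upd V p \<le> upd W p"
    by (rule upd_mono) (use assms(1,2) in \<open>auto simp: W_def\<close>)
  moreover have "upd W p \<le> upd V p"
  proof (rule update_le_update)
    fix x assume "V x < upd V p"
    then have "V x < V p" by (subst assms(3))
    then show "W x \<le> V x" by (simp add: W_def)
  next
    fix x assume "x \<in> nbrs X h p"
    then have "x \<in> X" by (rule nbrs_in)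
    then show "V x \<noteq> -\<infinity>" "W x \<noteq> -\<infinity>" using assms(1) nm by blast+
  qed (use assms(2) h_pos F_pos in auto)
  ultimately have eq: "V p = upd W p" unfolding assms(3) by (rule antisym)
  show ?thesis
  proof (cases "rank V p")
    \<comment> \<open>Nothing lies below \<open>V p\<close>, so the update sees only \<infinity>, a
      member of every \<open>vals n\<close>.\<close>
    case 0
    then have "\<not> V x < V p" if "x \<in> X" for x using rank_strict_mono[OF that, of V p] by fastforce
    then have "upd W p = \<infinity>" by (intro upd_PInf) (simp add: W_def)
    with eq have "V p = \<infinity>" by (rule trans)
    then show ?thesis using PInf_in_vals by simp
  next
    case (Suc n)
    have "W x \<in> vals n" if "x \<in> X" for x
    proof (cases "V x < V p")
      case True
      then have "rank V x \<le> n" using rank_strict_mono[OF that True] Suc by simp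
      then have "V x \<in> vals n" using assms(4)[OF that True] by (rule subsetD[OF vals_mono])
      then show ?thesis using True by (simp add: W_def)
    next
      case False
      then show ?thesis using PInf_in_vals by (simp add: W_def)
    qed
    then have "upd W p \<in> vals (rank V p)"
      using assms(2) unfolding Suc vals.simps
      by (intro UnI2 CollectI exI[of _ W] exI[of _ p] conjI refl ballI)
    with eq show ?thesis by simp
  qed
qed

section \<open>The loop invariant\<close>

text \<open>Exit values never change, so their cell announces them to its neighbors only at its
  first removal. Until then they count as absent.\<close>

definition visible :: "cell set \<Rightarrow> (point \<Rightarrow> ereal) \<Rightarrow> point \<Rightarrow> ereal" where
  "visible R V x = (if x \<in> Q \<and> x \<notin> \<Union>R then \<infinity> else V x)"

lemma visible_ge: "V x \<le> visible R V x"
  by (simp add: visible_def)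

text \<open>A cell outside the list has labels consistent with its neighbors, except that it need not have noticed
  the exit points of cells that were never removed from the list: these are hidden by \<open>visible\<close>.\<close>

definition valid_state :: "state \<Rightarrow> bool" where
  "valid_state = (\<lambda>(L, R, V). L \<subseteq> Z \<and> R \<subseteq> Z \<and>
     (\<forall>p\<in>Q. V p = ereal (q p)) \<and>
     (\<forall>p\<in>X. V p \<noteq> -\<infinity>) \<and>
     (\<forall>p\<in>X - Q. upd V p \<le> V p) \<and>
     (\<forall>c\<in>Z - R. c \<inter> Q \<noteq> {} \<longrightarrow> c \<in> L) \<and>
     (\<forall>c\<in>Z - L. \<forall>p\<in>c - Q. V p \<le> upd (visible R V) p) \<and>
     (\<forall>p\<in>X. V p \<in> vals (rank V p)))"

lemma valid_stateD:
  assumes "valid_state (L, R, V)"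
  shows "L \<subseteq> Z" "R \<subseteq> Z" "\<And>p. p \<in> Q \<Longrightarrow> V p = ereal (q p)" "\<And>p. p \<in> X \<Longrightarrow> V p \<noteq> -\<infinity>"
    "\<And>p. p \<in> X \<Longrightarrow> p \<notin> Q \<Longrightarrow> upd V p \<le> V p"
    "\<And>c. c \<in> Z \<Longrightarrow> c \<notin> R \<Longrightarrow> c \<inter> Q \<noteq> {} \<Longrightarrow> c \<in> L"
    "\<And>c p. c \<in> Z \<Longrightarrow> c \<notin> L \<Longrightarrow> p \<in> c \<Longrightarrow> p \<notin> Q \<Longrightarrow> V p \<le> upd (visible R V) p"
    "\<And>p. p \<in> X \<Longrightarrow> V p \<in> vals (rank V p)"
  using assms by (simp_all add: valid_state_def)

lemma valid_stateI:
  assumes "L \<subseteq> Z" "R \<subseteq> Z" "\<And>p. p \<in> Q \<Longrightarrow> V p = ereal (q p)" "\<And>p. p \<in> X \<Longrightarrow> V p \<noteq> -\<infinity>"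
    "\<And>p. p \<in> X \<Longrightarrow> p \<notin> Q \<Longrightarrow> upd V p \<le> V p"
    "\<And>c. c \<in> Z \<Longrightarrow> c \<notin> R \<Longrightarrow> c \<inter> Q \<noteq> {} \<Longrightarrow> c \<in> L"
    "\<And>c p. c \<in> Z \<Longrightarrow> c \<notin> L \<Longrightarrow> p \<in> c \<Longrightarrow> p \<notin> Q \<Longrightarrow> V p \<le> upd (visible R V) p"
    "\<And>p. p \<in> X \<Longrightarrow> V p \<in> vals (rank V p)"
  shows "valid_state (L, R, V)"
  unfolding valid_state_def prod.case
  by (intro conjI ballI impI) (simp_all add: assms(1-6,8), elim conjE, rule assms(7))

text \<open>Before any removal all exit points are hidden, so every update of the visible labels is
  \<infinity> and the subsolution inequality is trivial.\<close>

lemma valid_init: "valid_state (init_state Q q Z)"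
proof -
  let ?V = "\<lambda>p. if p \<in> Q then ereal (q p) else \<infinity>"
  have "upd (visible {} ?V) p = \<infinity>" for p
    by (rule upd_PInf) (simp add: visible_def)
  moreover have "?V p \<in> vals (rank ?V p)" for p
    using vals_mono[of 0 "rank ?V p"] by auto
  ultimately show ?thesis by (auto simp: valid_state_def init_state_def)
qed

text \<open>The decrease is the comparison principle on \<open>c - Q\<close>: the old labels are a
  supersolution there, the new ones satisfy the equations.\<close>

lemma process_le:
  assumes valid: "valid_state (L, R, V)" and "c \<in> L" and W: "cell_solution X h F Q q c V W"
    and V': "V' = (\<lambda>p. if p \<in> c then W p else V p)"
  shows "p \<in> X \<Longrightarrow> V' p \<noteq> -\<infinity>" "p \<in> X \<Longrightarrow> V' p \<le> V p" "p \<in> c - Q \<Longrightarrow> V' p = upd V' p"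
    "p \<in> Q \<Longrightarrow> V' p = ereal (q p)"
proof -
  note inv = valid_stateD[OF valid]
  have cX: "c \<subseteq> X" using assms(2) inv(1) cell_sub by auto
  show nm: "V' p \<noteq> -\<infinity>" if "p \<in> X" for p
    using inv(4)[OF that] W by (auto simp: V' cell_solution_def)
  show q: "V' p = ereal (q p)" if "p \<in> Q" for p
    using inv(3)[OF that] that W by (auto simp: V' cell_solution_def)
  show eq: "V' p = upd V' p" if "p \<in> c - Q" for p
    using cell_solution_update[OF W cX that] that by (simp add: V')
  have "V' p \<le> V p" if "p \<in> X" for p
  proof (rule comparison[where A = "c - Q"])
    fix x
    show "x \<in> X \<Longrightarrow> x \<notin> c - Q \<Longrightarrow> V' x \<le> V x"
      using q inv(3) by (cases "x \<in> Q") (auto simp: V')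
    show "x \<in> c - Q \<Longrightarrow> upd V x \<le> V x" using inv(5) cX by blast
    show "x \<in> c - Q \<Longrightarrow> V' x \<le> upd V' x" using eq by simp
  qed (use inv(4) nm that in auto)
  then show "p \<in> X \<Longrightarrow> V' p \<le> V p" by blast
qed

lemma valid_step:
  assumes "step X h F Q q Z s s'" and "valid_state s"
  shows "valid_state s'"
  using assms(1)
proof cases
  case (1 c L V W V' L' R)
  have valid: "valid_state (L, R, V)" using assms(2) 1 by simp
  note inv = valid_stateD[OF valid]
  note proc = process_le[OF valid 1(3,4,5)]
  let ?act = "{c' \<in> nbr_cells X h Z c - L'. activates X h Q (c \<notin> R) V V' c c'}"
  let ?R = "insert c R"
  have cZ: "c \<in> Z" using 1 inv(1) by auto
  have V'_out: "V' p = V p" if "p \<notin> c" for p using that 1 by simp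
  have nm_vis: "visible S V0 x \<noteq> -\<infinity>" if "V0 x \<noteq> -\<infinity>" for S V0 x
    using that by (simp add: visible_def)
  have super: "upd V' p \<le> V' p" if "p \<in> X" "p \<notin> Q" for p
  proof (cases "p \<in> c")
    case True
    then show ?thesis using proc(3) that by simp
  next
    case False
    \<comment> \<open>Neighbors may have dropped, which lowers the update, while the label of
      \<open>p\<close> is unchanged.\<close>
    have "upd V' p \<le> upd V p" using that proc by (intro upd_mono) auto
    then show ?thesis using inv(5)[OF that] V'_out[OF False] by simp
  qed
  have sub: "V' p \<le> upd (visible ?R V') p"
    if c': "c' \<in> Z" "c' \<notin> L' \<union> ?act" and p: "p \<in> c'" "p \<notin> Q" for c' p
  proof (cases "c' = c")
    case True
    have "p \<in> X" using c' p cell_sub by blast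
    have "V' p = upd V' p" using proc(3) p True by simp
    \<comment> \<open>Hiding exit points can only raise neighbor labels, hence the update.\<close>
    also have "\<dots> \<le> upd (visible ?R V') p"
      using proc(1) visible_ge \<open>p \<in> X\<close> by (intro upd_mono)
    finally show ?thesis .
  next
    case False
    have pX: "p \<in> X" using c' p cell_sub by blast
    have pc: "p \<notin> c" using cell_eq[OF c'(1) cZ p(1)] False by blast
    have L: "c' \<notin> L" using c' False 1 by auto
    show ?thesis
    proof (rule ccontr)
      assume "\<not> V' p \<le> upd (visible ?R V') p"
      then have lt: "upd (visible ?R V') p < V' p" by simp
      \<comment> \<open>Only neighbors whose visible label is below the new update, hence below
        \<open>V' p\<close>, matter. If such a neighbor lies in \<open>c\<close>, nonactivation
        means that its label did not change and that it was not newly revealed. So old and new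
        visible labels agree, and the old inequality at \<open>p\<close> is contradicted.\<close>
      have "upd (visible R V) p \<le> upd (visible ?R V') p"
      proof (rule update_le_update)
        fix x assume x: "x \<in> nbrs X h p" and lt_x: "visible ?R V' x < upd (visible ?R V') p"
        have xX: "x \<in> X" using x nbrs_in by blast
        have "visible R V x = visible ?R V' x"
        proof (cases "x \<in> c")
          case True
          have px: "p \<in> nbrs X h x" using x xX pX nbrs_commute by blast
          have "x \<notin> c'" using cell_eq[OF c'(1) cZ, of x] True False by blast
          then have fr: "x \<in> c \<inter> fringe X h c'" using True xX px p by (auto simp: fringe_def)
          have "c' \<in> nbr_cells X h Z c"
            using c' False True px p by (auto simp: nbr_cells_def)
          then have "\<not> activates X h Q (c \<notin> R) V V' c c'" using c' by blast
          moreover have "V' x < V' p"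
            using lt_x lt visible_ge[of V' x ?R] by (meson le_less_trans less_trans)
          moreover have "p \<in> (c' \<inter> nbrs X h x) - Q" using p px by blast
          ultimately have "V' x = V x" "x \<in> Q \<Longrightarrow> c \<in> R"
            using fr unfolding activates_def by blast+
          then show ?thesis using True by (auto simp: visible_def)
        next
          case False
          then show ?thesis by (simp add: visible_def V'_out)
        qed
        then show "visible R V x \<le> visible ?R V' x" by simp
      next
        fix x assume "x \<in> nbrs X h p"
        then have "x \<in> X" by (rule nbrs_in)
        then show "visible ?R V' x \<noteq> -\<infinity>" "visible R V x \<noteq> -\<infinity>"
          using nm_vis[OF proc(1)] nm_vis[OF inv(4)] by simp_all
      qed (use h_pos F_pos pX in auto)
      also note lt
      also have "V' p = V p" using V'_out pc by simp
      finally show False using inv(7)[OF c'(1) L p] by simp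
    qed
  qed
  have vals: "V' p \<in> vals (rank V' p)" if "p \<in> X" for p
    using that
  \<comment> \<open>A recomputed label depends on the new labels below it, which have smaller new
    rank.\<close>
  proof (induction "rank V' p" arbitrary: p rule: less_induct)
    case less
    show ?case
    proof (cases "p \<in> c - Q")
      case True
      show ?thesis
      proof (rule vals_rank_update)
        show "V' x \<in> vals (rank V' x)" if "x \<in> X" "V' x < V' p" for x
          using less(1)[OF rank_strict_mono[OF that] that(1)] .
      qed (use proc(1,3) True less(2) in simp_all)
    next
      case False
      then have eq: "V' p = V p" using V'_out[of p] proc(4)[of p] inv(3)[of p] by auto
      \<comment> \<open>Other labels have only decreased, so no point leaves the set that the rank
        counts.\<close>
      have "rank V p \<le> rank V' p"
        unfolding rank_def using fin_X proc(2) eq by (intro card_mono) (auto dest: le_less_trans)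
      then have "vals (rank V p) \<subseteq> vals (rank V' p)" by (rule vals_mono)
      then show ?thesis using inv(8)[OF less(2)] eq by (simp add: subset_iff)
    qed
  qed
  show ?thesis unfolding 1(2)
  proof (rule valid_stateI)
    show "L' \<union> ?act \<subseteq> Z" using inv(1) 1 by (auto simp: nbr_cells_def)
    show "?R \<subseteq> Z" using cZ inv(2) by simp
    show "d \<in> L' \<union> ?act" if "d \<in> Z" "d \<notin> ?R" "d \<inter> Q \<noteq> {}" for d
      using inv(6)[of d] that 1 by simp
  qed (fact proc(4) proc(1) super sub vals)+
qed

lemma valid_steps: "(step X h F Q q Z)\<^sup>*\<^sup>* (init_state Q q Z) s \<Longrightarrow> valid_state s"
  by (induction rule: rtranclp_induct) (auto intro: valid_init valid_step)

section \<open>Termination\<close>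

definition excess :: "(point \<Rightarrow> ereal) \<Rightarrow> nat" where
  "excess V = (\<Sum>p\<in>X. card {v \<in> vals (card X). v < V p})"

text \<open>The new label at \<open>x\<close> is itself attainable: it was counted below the old
  label and is not counted below itself.\<close>

lemma excess_less:
  assumes le: "\<And>p. p \<in> X \<Longrightarrow> W p \<le> V p" and vals: "\<And>p. p \<in> X \<Longrightarrow> W p \<in> vals (card X)"
    and "x \<in> X" "W x \<noteq> V x"
  shows "excess W < excess V"
  unfolding excess_def
proof (rule sum_strict_mono_ex1[OF fin_X])
  show "\<forall>p\<in>X. card {v \<in> vals (card X). v < W p} \<le> card {v \<in> vals (card X). v < V p}"
    using le finite_vals by (intro ballI card_mono) (auto dest: less_le_trans)
  have "W x < V x" using le assms by (simp add: less_le)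
  then have "{v \<in> vals (card X). v < W x} \<subset> {v \<in> vals (card X). v < V x}"
    using vals[OF \<open>x \<in> X\<close>] by (auto dest: less_trans)
  then show "\<exists>p\<in>X. card {v \<in> vals (card X). v < W p} < card {v \<in> vals (card X). v < V p}"
    using \<open>x \<in> X\<close> finite_vals by (intro bexI psubset_card_mono) auto
qed

definition progress :: "(state \<times> state) set" where
  "progress = measures [\<lambda>(L, R, V). excess V, \<lambda>(L, R, V). card (Z - R), \<lambda>(L, R, V). card L]"

text \<open>A changed label lowers the first component; otherwise a first removal lowers the second;
  otherwise nothing is activated and the list just loses \<open>c\<close>.\<close>

lemma step_progress:
  assumes "step X h F Q q Z s s'" and "valid_state s"
  shows "(s', s) \<in> progress"
  using assms(1)
proof cases
  case (1 c L V W V' L' R)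
  have valid: "valid_state (L, R, V)" using assms(2) 1 by simp
  have valid': "valid_state s'" using valid_step assms by blast
  note inv = valid_stateD[OF valid] and inv' = valid_stateD[OF valid'[unfolded 1(2)]]
  note proc = process_le[OF valid 1(3,4,5)]
  have cZ: "c \<in> Z" using 1 inv(1) by auto
  show ?thesis
  proof (cases "V' = V")
    case False
    then obtain x where x: "V' x \<noteq> V x" by blast
    then have "x \<in> X" using 1 cZ cell_sub by (auto split: if_splits)
    \<comment> \<open>The invariant after the step places the new labels in
      \<open>vals (card X)\<close>, as ranks never exceed \<open>card X\<close>.\<close>
    then have "excess V' < excess V"
      using x proc(2) inv'(8) vals_mono[OF rank_le_card]
      by (intro excess_less[of V' V x]) blast+
    then show ?thesis unfolding 1 progress_def by simp
  next
    case V: True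
    show ?thesis
    proof (cases "c \<in> R")
      case False
      then have "card (Z - insert c R) < card (Z - R)"
        using cZ fin_Z by (intro psubset_card_mono) auto
      then show ?thesis using V unfolding 1(1,2) progress_def by simp
    next
      case True
      then have no_act: "{c' \<in> nbr_cells X h Z c - L'. activates X h Q (c \<notin> R) V V' c c'} = {}"
        using V by (auto simp: activates_def)
      have "card L' < card L"
        using 1 inv(1) finite_subset[OF _ fin_Z] by (intro psubset_card_mono) auto
      then show ?thesis using V True unfolding 1(1,2) no_act progress_def
        by (simp add: insert_absorb)
    qed
  qed
qed

lemma no_infinite_run:
  "\<nexists>s. s 0 = init_state Q q Z \<and> (\<forall>n :: nat. step X h F Q q Z (s n) (s (Suc n)))"
proof
  assume "\<exists>s. s 0 = init_state Q q Z \<and> (\<forall>n :: nat. step X h F Q q Z (s n) (s (Suc n)))"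
  then obtain s where s: "s 0 = init_state Q q Z" "\<And>n. step X h F Q q Z (s n) (s (Suc n))"
    by blast
  have "valid_state (s n)" for n
    by (induction n) (use s valid_init valid_step in \<open>simp, blast\<close>)
  then have "(s (Suc n), s n) \<in> progress" for n using s(2) step_progress by blast
  moreover have "wf progress" unfolding progress_def by simp
  ultimately show False unfolding wf_iff_no_infinite_down_chain by blast
qed

section \<open>Labels at termination\<close>

lemma final_labels:
  assumes valid: "valid_state ({}, R, V)" and U: "eikonal_solution X h F Q q U" and "p \<in> X"
  shows "V p = ereal (U p)"
proof -
  let ?U = "\<lambda>x. ereal (U x)"
  note inv = valid_stateD[OF valid]
  have U_upd: "upd ?U x = ?U x" if "x \<in> X - Q" for x
    using that U h_pos F_pos by (intro eikonal_update) (auto simp: eikonal_solution_def)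
  have U_Q: "V x = ?U x" if "x \<in> Q" for x
    using that U inv(3) by (auto simp: eikonal_solution_def)
  have cell: "\<exists>c\<in>Z. x \<in> c" if "x \<in> X" for x
    using that part by (auto simp: partition_on_def)
  \<comment> \<open>With an empty list every cell meeting \<open>Q\<close> has been removed at least
    once, so no exit point is hidden.\<close>
  have "visible R V x = V x" if "x \<in> X" for x
    using cell[OF that] inv(6) by (auto simp: visible_def)
  then have "label_at X (visible R V) = label_at X V"
    by (auto simp: label_at_def)
  then have "upd (visible R V) x = upd V x" for x
    by (simp add: update_def)
  then have V_sub: "V x \<le> upd V x" if "x \<in> X - Q" for x
    using cell[of x] inv(7)[of _ x] that by auto
  show ?thesis
  proof (rule antisym)
    show "V p \<le> ?U p"
    proof (rule comparison[where A = "X - Q"])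
      fix x
      show "x \<in> X - Q \<Longrightarrow> upd ?U x \<le> ?U x" using U_upd by simp
      show "x \<in> X \<Longrightarrow> x \<notin> X - Q \<Longrightarrow> V x \<le> ?U x" using U_Q by simp
    qed (use inv(4) V_sub \<open>p \<in> X\<close> in auto)
    show "?U p \<le> V p"
    proof (rule comparison[where A = "X - Q"])
      fix x
      show "x \<in> X - Q \<Longrightarrow> ?U x \<le> upd ?U x" using U_upd by simp
      show "x \<in> X \<Longrightarrow> x \<notin> X - Q \<Longrightarrow> ?U x \<le> V x" using U_Q by simp
    qed (use inv(4,5) \<open>p \<in> X\<close> in auto)
  qed
qed

end

text \<open>Solvability of every listed cell is included so that a run cannot get stuck: it can
  always continue until the list is empty.\<close>

theorem theorem3p2:
  fixes X Q :: "point set" and h :: real and q F U :: "point \<Rightarrow> real" and Z :: "cell set"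
  assumes "h > 0"
    and "uniform_grid h X"
    and "Q \<subseteq> X"
    and "\<forall>p\<in>X. F p > 0"
    and "cell_decomposition X Z"
    and "eikonal_solution X h F Q q U"
  shows "(\<nexists>s. s 0 = init_state Q q Z \<and> (\<forall>n :: nat. step X h F Q q Z (s n) (s (Suc n))))
    \<and> (\<forall>L R V. (step X h F Q q Z)\<^sup>*\<^sup>* (init_state Q q Z) (L, R, V) \<longrightarrow>
         (\<forall>c\<in>L. \<exists>W. cell_solution X h F Q q c V W) \<and>
         (L = {} \<longrightarrow> (\<forall>p\<in>X. V p = ereal (U p))))"
proof -
  interpret eikonal_grid X Q h q F Z
    using assms by unfold_locales (auto simp: uniform_grid_def cell_decomposition_def)
  show ?thesis
  proof (intro conjI allI impI ballI)
    show "\<nexists>s. s 0 = init_state Q q Z \<and> (\<forall>n :: nat. step X h F Q q Z (s n) (s (Suc n)))"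
      by (rule no_infinite_run)
  next
    fix L R V
    assume "(step X h F Q q Z)\<^sup>*\<^sup>* (init_state Q q Z) (L, R, V)"
    then have valid: "valid_state (L, R, V)" by (rule valid_steps)
    show "\<exists>W. cell_solution X h F Q q c V W" if "c \<in> L" for c
      using valid_stateD(1,4)[OF valid] that cell_sub by (intro cell_solution_exists) blast+
    show "V p = ereal (U p)" if "L = {}" "p \<in> X" for p
      using final_labels valid assms(6) that by blast
  qed
qed

end
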